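(* Let $\{\lambda_n\}_{n\ge 0}\subset\mathbb{C}$ be a sequence with $\lambda_0=0$, and let $\{P_n\}_{n\ge 0}$ be a sequence of monic polynomials with complex coefficients, $\deg P_n=n$ for each $n$. Let the numbers $\delta_n^{(k)}$, the polynomials $a_n(x)$ and the infinite-order differential operator $L=\sum_{i=0}^{+\infty}a_i(x)\partial_x^i$ be defined in terms of $\{\lambda_n\}$ and $\{P_n\}$ as in the context. Let $N\ge 1$ be an integer. Then the following statements are equivalent: 1. $a_i(x)=0$ for all $i>N$, and $LP_n=\lambda_nP_n$ for all $n\ge 0$, i.e. $$\sum_{i=1}^{N}a_i(x)\partial_x^iP_n(x)=\lambda_nP_n(x)\qquad\text{for all } n\ge 0.$$ 2. One has $$\delta_n^{(k)}=\sum_{i=k}^{N}(-1)^{N-i}\binom{n}{i}\binom{n-i-1}{N-i}\delta_i^{(k)}\qquad\text{for all } n\ge N+1,\ 0\le k\le N,$$ and $\delta_n^{(k)}=0$ for all $n\ge k>N$.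
   Context: Write $P_n(x)=\sum_{j=0}^n b_{n,j}x^j$ with $b_{n,n}=1$, and set $b_{n,j}=0$ for $j>n$. Define, for $n=0,1,2,\dots$: $\delta_n^{(0)}=\lambda_n$; for $1\le k\le n$, $$\delta_n^{(k)}=(-1)^k\det(M^{(n,k)}),$$ where $M^{(n,k)}=(m_{r,c})_{1\le r,c\le k}$ is the $k\times k$ upper Hessenberg matrix with first row $$m_{1,c}=(\lambda_{n-k}-\lambda_{n-k+c})\,b_{n-k+c,\,n-k},\quad 1\le c\le k,$$ and remaining rows $$m_{r,c}=b_{n-k+c,\,n-k+r-1},\quad 2\le r\le k,\ 1\le c\le k$$ (so that $m_{r,r-1}=1$ and $m_{r,c}=0$ for $c<r-1$); and $\delta_n^{(k)}=0$ for $k>n$. Define the polynomials $a_n(x)=\sum_{i=0}^n a_{n,i}x^i$, $n=0,1,2,\dots$, by $$a_{n,n-k}=\frac{1}{n!}\sum_{i=k}^{n}\binom{n}{i}(-1)^{n-i}\delta_i^{(k)},\qquad k=0,1,\ldots,n.$$ Finally $L=\sum_{i=0}^{+\infty}a_i(x)\partial_x^i$, where $\partial_x^i$ is the $i$-th derivative with respect to $x$ (applied to a polynomial the sum is finite). Note that $a_0=\lambda_0=0$. *)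

theory Defs
  imports
    Complex_Main
    "HOL-Computational_Algebra.Polynomial"
    "Jordan_Normal_Form.Determinant"
begin

text \<open>Rows and columns of \<^typ>\<open>complex mat\<close> are numbered from \<open>0\<close>: entry \<open>(r, c)\<close> below is
  \<open>m\<close> with indices \<open>r + 1\<close> and \<open>c + 1\<close> in the usual numbering from \<open>1\<close>. The number
  \<open>b\<close> with indices \<open>n, j\<close> is \<open>coeff (P n) j\<close>. Only meant for \<open>1 \<le> k \<le> n\<close>.\<close>

definition delta_mat ::
  "(nat \<Rightarrow> complex) \<Rightarrow> (nat \<Rightarrow> complex poly) \<Rightarrow> nat \<Rightarrow> nat \<Rightarrow> complex mat" where
  "delta_mat lam P n k = mat k k (\<lambda>(r, c).
     if r = 0 then (lam (n - k) - lam (n - k + (c + 1))) * coeff (P (n - k + (c + 1))) (n - k)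
     else coeff (P (n - k + (c + 1))) (n - k + r))"

definition delta ::
  "(nat \<Rightarrow> complex) \<Rightarrow> (nat \<Rightarrow> complex poly) \<Rightarrow> nat \<Rightarrow> nat \<Rightarrow> complex" where
  "delta lam P n k =
     (if k = 0 then lam n
      else if k \<le> n then (- 1) ^ k * det (delta_mat lam P n k)
      else 0)"

definition diffop_poly ::
  "(nat \<Rightarrow> complex) \<Rightarrow> (nat \<Rightarrow> complex poly) \<Rightarrow> nat \<Rightarrow> complex poly" where
  "diffop_poly lam P n =
     (\<Sum>k = 0..n. monom
        (1 / fact n * (\<Sum>i = k..n. of_nat (n choose i) * (- 1) ^ (n - i) * delta lam P i k))
        (n - k))"

text \<open>The series \<open>L\<close> is truncated at the degree of its argument, as higher derivatives vanish;
  any larger cut-off gives the same value.\<close>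

definition diffop ::
  "(nat \<Rightarrow> complex) \<Rightarrow> (nat \<Rightarrow> complex poly) \<Rightarrow> complex poly \<Rightarrow> complex poly" where
  "diffop lam P p = (\<Sum>i = 0..degree p. diffop_poly lam P i * (pderiv ^^ i) p)"

lemma diffop_eq_sum:
  assumes "degree p \<le> M"
  shows "diffop lam P p = (\<Sum>i = 0..M. diffop_poly lam P i * (pderiv ^^ i) p)"
proof -
  have "(pderiv ^^ i) p = 0" if "degree p < i" for i
    using that by (intro poly_eqI) (simp add: coeff_higher_pderiv coeff_eq_0)
  then show ?thesis
    unfolding diffop_def using assms by (intro sum.mono_neutral_left) auto
qed

lemma diffop_eq_sum_finite_order:
  assumes "lam 0 = 0" and "\<And>i. i > N \<Longrightarrow> diffop_poly lam P i = 0"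
  shows "diffop lam P p = (\<Sum>i = 1..N. diffop_poly lam P i * (pderiv ^^ i) p)"
proof -
  have a0: "diffop_poly lam P 0 = 0"
    using assms(1) by (simp add: diffop_poly_def delta_def)
  have "diffop lam P p = (\<Sum>i = 0..max N (degree p). diffop_poly lam P i * (pderiv ^^ i) p)"
    by (rule diffop_eq_sum) simp
  also have "\<dots> = (\<Sum>i = 1..N. diffop_poly lam P i * (pderiv ^^ i) p)"
  proof (rule sum.mono_neutral_right)
    show "\<forall>i\<in>{0..max N (degree p)} - {1..N}. diffop_poly lam P i * (pderiv ^^ i) p = 0"
    proof
      fix i assume "i \<in> {0..max N (degree p)} - {1..N}"
      then have "i = 0 \<or> i > N" by auto
      then show "diffop_poly lam P i * (pderiv ^^ i) p = 0" using a0 assms(2) by auto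
    qed
  qed auto
  finally show ?thesis .
qed

end

theory Submission
  imports Defs
begin

text \<open>
  Let \<open>T\<close> be the linear operator on polynomials with \<open>T (P n) = \<lambda>\<^sub>n (P n)\<close>. Two observations drive
  the proof.

  First, \<open>\<delta>\<close> is the matrix of \<open>T\<close> in the monomial basis:
  \<open>T x\<^sup>n = (\<Sum>k\<le>n. \<delta> n k x\<^bsup>n-k\<^esup>)\<close>. Comparing coefficients of \<open>x\<^sup>j\<close> in \<open>T (P n) = \<lambda>\<^sub>n (P n)\<close> gives a
  unitriangular linear system for the numbers \<open>\<delta> (j + k) k\<close>, \<open>k \<ge> 1\<close>, and the Hessenberg
  determinants are its solution by Cramer's rule (\<open>det_hessenberg\<close>, \<open>delta_linear_system\<close>).

  Second, the operator \<open>L\<close> acts on monomials in the same way (\<open>diffop_monom\<close>). Indeed, up to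
  the factor \<open>1 / n!\<close> the coefficients of \<open>a\<^sub>n\<close> are the \<open>n\<close>-th forward differences at \<open>0\<close> of the sequences
  \<open>i \<mapsto> \<delta> i k\<close>, and applying \<open>\<partial>\<^sup>i\<close> to \<open>x\<^sup>n\<close> produces the binomial coefficients that invert this
  difference transform. Hence \<open>L = T\<close>, and the eigenvalue equation \<open>L (P n) = \<lambda>\<^sub>n (P n)\<close> holds for every
  choice of the data (\<open>diffop_eigenvector\<close>).

  What remains is that \<open>a\<^sub>i\<close> vanishes for \<open>i > N\<close>, that is, for each \<open>k\<close> all forward differences of
  \<open>i \<mapsto> \<delta> i k\<close> of order above \<open>N\<close> vanish. By Newton's interpolation formula this says that the
  sequence is a polynomial of degree at most \<open>N\<close> in \<open>i\<close>, hence is given by its values at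
  \<open>0, \<dots>, N\<close>; the sum in the second statement is the Lagrange form of that interpolation polynomial
  (\<open>newton_partial_sum_lagrange\<close>). When \<open>k > N\<close> those values are all \<open>0\<close>, so the whole sequence is.
\<close>

section \<open>Forward differences and interpolation\<close>

text \<open>The differences are taken at \<open>0\<close>: in terms of \<open>\<Delta> f i = f (i + 1) - f i\<close> this is \<open>(\<Delta>\<^sup>n f) 0\<close>.\<close>

definition forward_diff :: "(nat \<Rightarrow> 'a :: comm_ring_1) \<Rightarrow> nat \<Rightarrow> 'a" where
  "forward_diff f n = (\<Sum>i\<le>n. of_nat (n choose i) * (- 1) ^ (n - i) * f i)"

lemma alternating_choose_partial_sum:
  "(\<Sum>j\<le>m. (- 1) ^ j * of_nat (Suc a choose j)) = (- 1) ^ m * (of_nat (a choose m) :: 'a :: comm_ring_1)"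
  by (induction m) (simp_all add: algebra_simps)

text \<open>Written as a linear combination of the values of \<open>f\<close>, a partial sum of Newton's series
  has alternating row sums of binomial coefficients as weights, because
  \<open>(n choose m) * (m choose i) = (n choose i) * ((n - i) choose (m - i))\<close>.\<close>

lemma newton_partial_sum:
  assumes "M \<le> n"
  shows "(\<Sum>m\<le>M. of_nat (n choose m) * forward_diff f m) =
    (\<Sum>i\<le>M. of_nat (n choose i) * (\<Sum>j\<le>M - i. (- 1) ^ j * of_nat ((n - i) choose j)) * f i)"
proof -
  have "(\<Sum>m\<le>M. of_nat (n choose m) * forward_diff f m) =
     (\<Sum>m\<le>M. \<Sum>i\<le>m. of_nat (n choose m) * (of_nat (m choose i) * (- 1) ^ (m - i) * f i))"
    by (simp add: forward_diff_def sum_distrib_left)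
  also have "\<dots> = (\<Sum>i\<le>M. \<Sum>m=i..M. of_nat (n choose m) * (of_nat (m choose i) * (- 1) ^ (m - i) * f i))"
    by (simp add: sum.Sigma)
       (rule sum.reindex_bij_witness[of _ "\<lambda>(i, m). (m, i)" "\<lambda>(m, i). (i, m)"]; auto)
  also have "\<dots> = (\<Sum>i\<le>M. of_nat (n choose i) * (\<Sum>j\<le>M - i. (- 1) ^ j * of_nat ((n - i) choose j)) * f i)"
  proof (intro sum.cong refl)
    fix i assume i: "i \<in> {..M}"
    have "(\<Sum>m=i..M. of_nat (n choose m) * (of_nat (m choose i) * (- 1) ^ (m - i) * f i)) =
      (\<Sum>j\<le>M - i. of_nat (n choose (j + i)) * (of_nat ((j + i) choose i) * (- 1) ^ j * f i))"
      using i by (intro sum.reindex_bij_witness[of _ "\<lambda>j. j + i" "\<lambda>m. m - i"]) auto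
    also have "\<dots> = (\<Sum>j\<le>M - i. of_nat (n choose i) * ((- 1) ^ j * of_nat ((n - i) choose j)) * f i)"
    proof (intro sum.cong refl)
      fix j assume "j \<in> {..M - i}"
      then have "(n choose (j + i)) * ((j + i) choose i) = (n choose i) * ((n - i) choose j)"
        using choose_mult[of i "j + i" n] i assms by simp
      then have *: "of_nat (n choose (j + i)) * of_nat ((j + i) choose i) =
          (of_nat (n choose i) * of_nat ((n - i) choose j) :: 'a)"
        by (metis of_nat_mult)
      show "of_nat (n choose (j + i)) * (of_nat ((j + i) choose i) * (- 1) ^ j * f i) =
          of_nat (n choose i) * ((- 1) ^ j * of_nat ((n - i) choose j)) * f i"
        using arg_cong[OF *, of "\<lambda>x. x * ((- 1) ^ j * f i)"] by (simp add: algebra_simps)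
    qed
    finally show "(\<Sum>m=i..M. of_nat (n choose m) * (of_nat (m choose i) * (- 1) ^ (m - i) * f i)) =
        of_nat (n choose i) * (\<Sum>j\<le>M - i. (- 1) ^ j * of_nat ((n - i) choose j)) * f i"
      by (simp add: sum_distrib_left sum_distrib_right)
  qed
  finally show ?thesis .
qed

lemma newton_inversion:
  "(\<Sum>m\<le>n. of_nat (n choose m) * forward_diff f m) = f n"
proof -
  \<comment> \<open>For \<open>M = n\<close> the alternating sums run over whole rows, so only the one for \<open>i = n\<close> survives.\<close>
  have "(\<Sum>j\<le>n - i. (- 1) ^ j * of_nat ((n - i) choose j)) = (of_bool (i = n) :: 'a)" if "i \<le> n" for i
    using choose_alternating_sum[of "n - i", where 'a = 'a] that by (cases "i = n") auto
  then have "(\<Sum>m\<le>n. of_nat (n choose m) * forward_diff f m) =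
      (\<Sum>i\<le>n. of_nat (n choose i) * of_bool (i = n) * f i)"
    by (simp add: newton_partial_sum)
  also have "\<dots> = (\<Sum>i\<in>{n}. of_nat (n choose i) * of_bool (i = n) * f i)"
    by (rule sum.mono_neutral_right) auto
  finally show ?thesis by simp
qed

text \<open>Newton's and Lagrange's form of the polynomial that interpolates \<open>f\<close> at \<open>0, \<dots>, M\<close>, evaluated at a
  point \<open>n\<close> beyond the nodes.\<close>

lemma newton_partial_sum_lagrange:
  assumes "M < n"
  shows "(\<Sum>m\<le>M. of_nat (n choose m) * forward_diff f m) =
    (\<Sum>i\<le>M. (- 1) ^ (M - i) * of_nat (n choose i) * of_nat ((n - i - 1) choose (M - i)) * f i)"
proof -
  have "(\<Sum>j\<le>M - i. (- 1) ^ j * of_nat ((n - i) choose j)) =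
      (- 1) ^ (M - i) * (of_nat ((n - i - 1) choose (M - i)) :: 'a)" if "i \<le> M" for i
    using alternating_choose_partial_sum[of "n - i - 1" "M - i", where 'a = 'a] that assms
    by (simp add: Suc_diff_Suc)
  then show ?thesis
    using assms newton_partial_sum[of M n f] by (simp add: mult_ac)
qed

lemma forward_diff_vanish_iff_newton:
  "(\<forall>n>M. forward_diff f n = 0) \<longleftrightarrow>
   (\<forall>n>M. f n = (\<Sum>m\<le>M. of_nat (n choose m) * forward_diff f m))"
proof (intro iffI allI impI)
  fix n assume van: "\<forall>n>M. forward_diff f n = 0" and n: "M < n"
  have "f n = (\<Sum>m\<le>n. of_nat (n choose m) * forward_diff f m)"
    by (simp add: newton_inversion)
  also have "\<dots> = (\<Sum>m\<le>M. of_nat (n choose m) * forward_diff f m)"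
    using n van by (intro sum.mono_neutral_right) auto
  finally show "f n = (\<Sum>m\<le>M. of_nat (n choose m) * forward_diff f m)" .
next
  fix n assume newton: "\<forall>n>M. f n = (\<Sum>m\<le>M. of_nat (n choose m) * forward_diff f m)"
  assume "M < n"
  then show "forward_diff f n = 0"
  proof (induction n rule: less_induct)
    case (less n)
    \<comment> \<open>By induction only the terms up to \<open>M\<close> and the last one of Newton's series at \<open>n\<close> survive.\<close>
    have "f n = (\<Sum>m\<le>n. of_nat (n choose m) * forward_diff f m)"
      by (simp add: newton_inversion)
    also have "\<dots> = (\<Sum>m\<in>insert n {..M}. of_nat (n choose m) * forward_diff f m)"
      using less by (intro sum.mono_neutral_right) auto
    also have "\<dots> = forward_diff f n + f n"
      using less.prems newton by simp
    finally show ?case by simp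
  qed
qed

lemma forward_diff_vanish_iff_lagrange:
  "(\<forall>n>M. forward_diff f n = 0) \<longleftrightarrow>
   (\<forall>n>M. f n = (\<Sum>i\<le>M. (- 1) ^ (M - i) * of_nat (n choose i) *
      of_nat ((n - i - 1) choose (M - i)) * f i))"
  unfolding forward_diff_vanish_iff_newton by (simp add: newton_partial_sum_lagrange)

section \<open>Hessenberg determinants and unitriangular systems\<close>

definition hessenberg :: "(nat \<Rightarrow> 'a) \<Rightarrow> (nat \<Rightarrow> nat \<Rightarrow> 'a) \<Rightarrow> nat \<Rightarrow> 'a mat" where
  "hessenberg u b k = mat k k (\<lambda>(r, c). if r = 0 then u (Suc c) else b (Suc c) r)"

text \<open>Expansion along the first row: the minor of its last entry is upper unitriangular.\<close>

lemma det_hessenberg_reduced: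
  fixes A :: "'a :: comm_ring_1 mat"
  assumes A: "A \<in> carrier_mat (Suc m) (Suc m)"
    and first: "\<And>c. c < m \<Longrightarrow> A $$ (0, c) = 0"
    and unit: "\<And>r. r < m \<Longrightarrow> A $$ (Suc r, r) = 1"
    and zero: "\<And>r c. c < r \<Longrightarrow> r < m \<Longrightarrow> A $$ (Suc r, c) = 0"
  shows "det A = (- 1) ^ m * A $$ (0, m)"
proof -
  have minor: "mat_delete A 0 m \<in> carrier_mat m m"
    using A by (simp add: mat_delete_def)
  have "det (mat_delete A 0 m) = prod_list (diag_mat (mat_delete A 0 m))"
    using A minor zero by (intro det_upper_triangular[of _ m]) (auto simp: mat_delete_def)
  also have "\<dots> = 1"
    using A unit by (simp add: prod_list_diag_prod mat_delete_def)
  finally have "cofactor A 0 m = (- 1) ^ m"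
    by (simp add: cofactor_def)
  then show ?thesis
    using laplace_expansion_row[OF A, of 0] first by (simp add: lessThan_Suc)
qed

text \<open>If \<open>D\<close> solves the first \<open>k - 1\<close> equations of the system, adding \<open>D r\<close> times row \<open>r\<close> to row
  \<open>0\<close>, for all \<open>r > 0\<close>, clears row \<open>0\<close> except for its last entry, where the data of
  the \<open>k\<close>-th equation appear.\<close>

lemma det_hessenberg:
  fixes u D :: "nat \<Rightarrow> 'a :: comm_ring_1"
  assumes unit: "\<And>c. b c c = 1"
    and zero: "\<And>c r. c < r \<Longrightarrow> b c r = 0"
    and sol: "\<And>c. 1 \<le> c \<Longrightarrow> c < k \<Longrightarrow> D c + (\<Sum>s = 1..<c. D s * b c s) = - u c"
    and k: "1 \<le> k"
  shows "det (hessenberg u b k) = - ((- 1) ^ k * (u k + (\<Sum>s = 1..<k. D s * b k s)))"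
proof -
  obtain m where m: "k = Suc m" using k by (cases k) auto
  define A where "A = mat k k (\<lambda>(r, c). if r = c then 1 else if r = 0 then D c else (0 :: 'a))"
  define H where "H = hessenberg u b k"
  have AC: "A \<in> carrier_mat k k" and HC: "H \<in> carrier_mat k k"
    by (simp_all add: A_def H_def hessenberg_def)
  have "det A = prod_list (diag_mat A)"
    by (rule det_upper_triangular[OF _ AC]) (auto simp: A_def)
  then have detA: "det A = 1"
    by (simp add: prod_list_diag_prod A_def)
  have split0: "{..<k} = insert 0 {1..<k}" using k by auto
  have row0: "(A * H) $$ (0, c) = u (Suc c) + (\<Sum>s = 1..<k. D s * b (Suc c) s)" if "c < k" for c
  proof -
    have "(A * H) $$ (0, c) = (\<Sum>i<k. A $$ (0, i) * H $$ (i, c))"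
      using AC HC that k by (simp add: scalar_prod_def lessThan_atLeast0)
    also have "\<dots> = u (Suc c) + (\<Sum>s = 1..<k. D s * b (Suc c) s)"
      using that k by (simp add: split0 A_def H_def hessenberg_def)
    finally show ?thesis .
  qed
  have rows: "(A * H) $$ (Suc r, c) = b (Suc c) (Suc r)" if "c < k" "Suc r < k" for r c
  proof -
    have "(A * H) $$ (Suc r, c) = (\<Sum>i<k. A $$ (Suc r, i) * H $$ (i, c))"
      using AC HC that by (simp add: scalar_prod_def lessThan_atLeast0)
    also have "\<dots> = (\<Sum>i\<in>{Suc r}. A $$ (Suc r, i) * H $$ (i, c))"
      using that by (intro sum.mono_neutral_right) (auto simp: A_def)
    also have "\<dots> = b (Suc c) (Suc r)"
      using that by (simp add: A_def H_def hessenberg_def)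
    finally show ?thesis .
  qed
  have cleared: "(A * H) $$ (0, c) = 0" if "c < m" for c
  proof -
    have "(\<Sum>s = 1..<k. D s * b (Suc c) s) = (\<Sum>s\<in>insert (Suc c) {1..<Suc c}. D s * b (Suc c) s)"
      using that m by (intro sum.mono_neutral_right) (auto simp: zero not_less le_less)
    also have "\<dots> = D (Suc c) + (\<Sum>s = 1..<Suc c. D s * b (Suc c) s)"
      by (simp add: unit)
    also have "\<dots> = - u (Suc c)"
      using that m by (intro sol) auto
    finally show ?thesis
      using row0[of c] that m by simp
  qed
  have "det (A * H) = (- 1) ^ m * (A * H) $$ (0, m)"
    by (rule det_hessenberg_reduced)
       (use AC HC m cleared in \<open>auto simp: rows unit zero simp del: index_mult_mat(1)\<close>)
  moreover have "det (A * H) = det H"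
    using det_mult[OF AC HC] detA by simp
  ultimately show ?thesis
    using row0[of m] m by (simp add: H_def)
qed

text \<open>This is the equation for the coefficient of \<open>x\<^sup>j\<close>, with \<open>n = j + k\<close>, in \<open>T (P n) = \<lambda>\<^sub>n (P n)\<close>, after
  the contribution of \<open>\<delta> j 0 = \<lambda>\<^sub>j\<close> has been moved to the right-hand side.\<close>

lemma delta_linear_system:
  assumes deg: "\<And>n. degree (P n) = n"
    and monic: "\<And>n. lead_coeff (P n) = 1"
    and "1 \<le> k"
  shows "delta lam P (j + k) k + (\<Sum>s = 1..<k. delta lam P (j + s) s * coeff (P (j + k)) (j + s)) =
    (lam (j + k) - lam j) * coeff (P (j + k)) j"
  using \<open>1 \<le> k\<close>
proof (induction k rule: less_induct)
  case (less k)
  define u where "u c = (lam j - lam (j + c)) * coeff (P (j + c)) j" for c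
  define b where "b c r = coeff (P (j + c)) (j + r)" for c r
  define D where "D s = delta lam P (j + s) s" for s
  have "delta_mat lam P (j + k) k = hessenberg u b k"
    unfolding delta_mat_def hessenberg_def u_def b_def by (intro cong_mat) (auto simp: add_ac)
  then have D: "D k = (- 1) ^ k * det (hessenberg u b k)"
    using less.prems by (simp add: D_def delta_def)
  have "det (hessenberg u b k) = - ((- 1) ^ k * (u k + (\<Sum>s = 1..<k. D s * b k s)))"
  proof (rule det_hessenberg)
    show "b c c = 1" for c
      using monic[of "j + c"] deg[of "j + c"] by (simp add: b_def)
    show "b c r = 0" if "c < r" for c r
      using that deg[of "j + c"] by (simp add: b_def coeff_eq_0)
    show "D c + (\<Sum>s = 1..<c. D s * b c s) = - u c" if "1 \<le> c" "c < k" for c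
      using less.IH[of c] that by (simp add: D_def b_def u_def algebra_simps)
  qed (use less.prems in simp)
  then have "D k = - (u k + (\<Sum>s = 1..<k. D s * b k s))"
    using D by (simp flip: mult.assoc power_mult_distrib)
  then show ?case
    by (simp add: D_def b_def u_def algebra_simps)
qed

section \<open>The operator on monomials\<close>

lemma delta_eq_0: "n < k \<Longrightarrow> delta lam P n k = 0"
  by (simp add: delta_def)

lemma diffop_poly_eq_forward_diff:
  "diffop_poly lam P n = (\<Sum>k\<le>n. monom (forward_diff (\<lambda>i. delta lam P i k) n / fact n) (n - k))"
proof -
  have "(\<Sum>i = k..n. of_nat (n choose i) * (- 1) ^ (n - i) * delta lam P i k) =
      forward_diff (\<lambda>i. delta lam P i k) n" for k
    unfolding forward_diff_def by (intro sum.mono_neutral_left) (auto simp: delta_eq_0)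
  then show ?thesis
    by (simp add: diffop_poly_def atLeast0AtMost)
qed

lemma forward_diff_delta_eq_0: "n < k \<Longrightarrow> forward_diff (\<lambda>i. delta lam P i k) n = 0"
  by (simp add: forward_diff_def delta_eq_0)

lemma diffop_poly_eq_0_iff:
  "diffop_poly lam P n = 0 \<longleftrightarrow> (\<forall>k. forward_diff (\<lambda>i. delta lam P i k) n = 0)"
proof
  assume zero: "diffop_poly lam P n = 0"
  show "\<forall>k. forward_diff (\<lambda>i. delta lam P i k) n = 0"
  proof
    fix k
    show "forward_diff (\<lambda>i. delta lam P i k) n = 0"
    proof (cases "k \<le> n")
      case True
      have "0 = coeff (diffop_poly lam P n) (n - k)" using zero by simp
      also have "\<dots> = (\<Sum>l\<le>n. if n - l = n - k then forward_diff (\<lambda>i. delta lam P i l) n / fact n else 0)"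
        by (simp add: diffop_poly_eq_forward_diff coeff_sum)
      also have "\<dots> = (\<Sum>l\<in>{k}. forward_diff (\<lambda>i. delta lam P i l) n / fact n)"
        using True by (intro sum.mono_neutral_cong_right) auto
      finally show ?thesis by simp
    qed (simp add: forward_diff_delta_eq_0)
  qed
qed (simp add: diffop_poly_eq_forward_diff)

text \<open>The term \<open>a\<^sub>i \<partial>\<^sup>i x\<^sup>m\<close> carries the factor \<open>i! (m choose i)\<close>, so summing over \<open>i\<close> turns the forward
  differences stored in \<open>a\<^sub>i\<close> back into \<open>\<delta> m k\<close>.\<close>

lemma diffop_poly_sum_monom:
  assumes "m \<le> M"
  shows "(\<Sum>i\<le>M. diffop_poly lam P i * (pderiv ^^ i) (monom c m)) =
    (\<Sum>k\<le>m. monom (c * delta lam P m k) (m - k))"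
proof -
  let ?d = "\<lambda>i k. forward_diff (\<lambda>i. delta lam P i k) i"
  have deriv: "(pderiv ^^ i) (monom c m) = monom (c * fact i * of_nat (m choose i)) (m - i)"
    if "i \<le> m" for i
  proof -
    have "pochhammer (of_nat (Suc (m - i))) i = (fact m / fact (m - i) :: complex)"
      using pochhammer_product[of "m - i" m "1 :: complex"] that
      by (simp add: pochhammer_fact[symmetric] field_simps)
    with that show ?thesis
      by (intro poly_eqI) (auto simp: coeff_higher_pderiv binomial_fact)
  qed
  have "(pderiv ^^ i) (monom c m) = 0" if "m < i" for i
    using that by (intro poly_eqI) (simp add: coeff_higher_pderiv)
  then have "(\<Sum>i\<le>M. diffop_poly lam P i * (pderiv ^^ i) (monom c m)) =
      (\<Sum>i\<le>m. diffop_poly lam P i * (pderiv ^^ i) (monom c m))"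
    using assms by (intro sum.mono_neutral_right) auto
  also have "\<dots> = (\<Sum>i\<le>m. \<Sum>k\<le>i. monom (c * (of_nat (m choose i) * ?d i k)) (m - k))"
    by (intro sum.cong refl)
       (auto simp: deriv diffop_poly_eq_forward_diff sum_distrib_right mult_monom intro!: sum.cong)
  also have "\<dots> = (\<Sum>i\<le>m. \<Sum>k\<le>m. monom (c * (of_nat (m choose i) * ?d i k)) (m - k))"
    by (intro sum.cong refl sum.mono_neutral_left) (auto simp: forward_diff_delta_eq_0)
  also have "\<dots> = (\<Sum>k\<le>m. \<Sum>i\<le>m. monom (c * (of_nat (m choose i) * ?d i k)) (m - k))"
    by (rule sum.swap)
  also have "\<dots> = (\<Sum>k\<le>m. monom (c * (\<Sum>i\<le>m. of_nat (m choose i) * ?d i k)) (m - k))"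
    by (simp add: sum_distrib_left monom_sum)
  finally show ?thesis
    by (simp add: newton_inversion)
qed

lemma diffop_sum_monom:
  "diffop lam P p = (\<Sum>m\<le>degree p. \<Sum>k\<le>m. monom (coeff p m * delta lam P m k) (m - k))"
proof -
  have "diffop lam P p = (\<Sum>i\<le>degree p. diffop_poly lam P i *
      (pderiv ^^ i) (\<Sum>m\<le>degree p. monom (coeff p m) m))"
    by (simp add: diffop_def atLeast0AtMost poly_as_sum_of_monoms)
  also have "\<dots> = (\<Sum>m\<le>degree p. \<Sum>i\<le>degree p. diffop_poly lam P i * (pderiv ^^ i) (monom (coeff p m) m))"
    unfolding higher_pderiv_sum sum_distrib_left by (rule sum.swap)
  finally show ?thesis
    by (simp add: diffop_poly_sum_monom)
qed

lemma coeff_diffop: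
  "coeff (diffop lam P p) j = (\<Sum>m = j..degree p. coeff p m * delta lam P m (m - j))"
proof -
  have inner: "coeff (\<Sum>k\<le>m. monom (coeff p m * delta lam P m k) (m - k)) j =
      (if j \<le> m then coeff p m * delta lam P m (m - j) else 0)" for m
  proof (cases "j \<le> m")
    case True
    have "(\<Sum>k\<le>m. if m - k = j then coeff p m * delta lam P m k else 0) =
        (\<Sum>k\<in>{m - j}. coeff p m * delta lam P m k)"
      using True by (intro sum.mono_neutral_cong_right) auto
    with True show ?thesis by (simp add: coeff_sum)
  qed (auto simp: coeff_sum intro!: sum.neutral)
  show ?thesis
    unfolding diffop_sum_monom coeff_sum[of _ "{..degree p}"] inner
    by (intro sum.mono_neutral_cong_right) auto
qed

lemma diffop_eigenvector:
  assumes deg: "\<And>n. degree (P n) = n"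
    and monic: "\<And>n. lead_coeff (P n) = 1"
  shows "diffop lam P (P n) = smult (lam n) (P n)"
proof (rule poly_eqI)
  fix j
  show "coeff (diffop lam P (P n)) j = coeff (smult (lam n) (P n)) j"
  proof (cases "j < n")
    case True
    define k where "k = n - j"
    have n: "n = j + k" and k: "1 \<le> k" using True by (auto simp: k_def)
    have "coeff (diffop lam P (P n)) j = (\<Sum>m = j..n. coeff (P n) m * delta lam P m (m - j))"
      by (simp add: coeff_diffop deg)
    also have "\<dots> = (\<Sum>s\<le>k. coeff (P n) (j + s) * delta lam P (j + s) s)"
      by (intro sum.reindex_bij_witness[of _ "\<lambda>s. j + s" "\<lambda>m. m - j"]) (auto simp: n)
    also have "{..k} = insert 0 (insert k {1..<k})" using k by auto
    also have "(\<Sum>s\<in>insert 0 (insert k {1..<k}). coeff (P n) (j + s) * delta lam P (j + s) s) =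
        lam j * coeff (P n) j + (delta lam P n k + (\<Sum>s = 1..<k. delta lam P (j + s) s * coeff (P n) (j + s)))"
      using k monic[of n] deg[of n] by (simp add: n delta_def[of _ _ _ 0] mult_ac)
    also have "\<dots> = lam n * coeff (P n) j"
      using delta_linear_system[of P k lam j, OF deg monic k] by (simp add: n algebra_simps)
    finally show ?thesis by simp
  next
    case False
    then show ?thesis
      using monic[of n] by (cases "j = n") (auto simp: coeff_diffop deg delta_def coeff_eq_0)
  qed
qed

section \<open>Characterization of finite order\<close>

lemma forward_diff_delta_vanish_iff:
  assumes "N < k"
  shows "(\<forall>n>N. forward_diff (\<lambda>i. delta lam P i k) n = 0) \<longleftrightarrow> (\<forall>n\<ge>k. delta lam P n k = 0)"
proof -
  \<comment> \<open>The interpolation nodes \<open>0, \<dots>, N\<close> all lie below \<open>k\<close>, where the sequence is \<open>0\<close>.\<close>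
  have "(\<forall>n>N. forward_diff (\<lambda>i. delta lam P i k) n = 0) \<longleftrightarrow> (\<forall>n>N. delta lam P n k = 0)"
    unfolding forward_diff_vanish_iff_lagrange using assms by (simp add: delta_eq_0)
  also have "\<dots> \<longleftrightarrow> (\<forall>n\<ge>k. delta lam P n k = 0)"
    using assms by (meson delta_eq_0 less_le_trans not_le)
  finally show ?thesis .
qed

theorem theorem6:
  fixes lam :: "nat \<Rightarrow> complex" and P :: "nat \<Rightarrow> complex poly" and N :: nat
  assumes "lam 0 = 0"
    and "\<And>n. degree (P n) = n"
    and "\<And>n. lead_coeff (P n) = 1"
    and "N \<ge> 1"
  shows "((\<forall>i > N. diffop_poly lam P i = 0) \<and>
          (\<forall>n. diffop lam P (P n) = smult (lam n) (P n)))
     \<longleftrightarrow>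
         ((\<forall>n k. n \<ge> N + 1 \<and> k \<le> N \<longrightarrow>
             delta lam P n k =
               (\<Sum>i = k..N. (- 1) ^ (N - i) * of_nat (n choose i) *
                  of_nat ((n - i - 1) choose (N - i)) * delta lam P i k)) \<and>
          (\<forall>n k. n \<ge> k \<and> k > N \<longrightarrow> delta lam P n k = 0))"
proof -
  have lagrange: "(\<Sum>i = k..N. (- 1) ^ (N - i) * of_nat (n choose i) *
        of_nat ((n - i - 1) choose (N - i)) * delta lam P i k) =
      (\<Sum>i\<le>N. (- 1) ^ (N - i) * of_nat (n choose i) *
        of_nat ((n - i - 1) choose (N - i)) * delta lam P i k)" for n k
    by (rule sum.mono_neutral_left) (auto simp: delta_eq_0)
  have "(\<forall>i>N. diffop_poly lam P i = 0) \<longleftrightarrow>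
      (\<forall>k\<le>N. \<forall>n>N. forward_diff (\<lambda>i. delta lam P i k) n = 0) \<and>
      (\<forall>k>N. \<forall>n>N. forward_diff (\<lambda>i. delta lam P i k) n = 0)"
    unfolding diffop_poly_eq_0_iff by (meson not_le)
  also have "(\<forall>k\<le>N. \<forall>n>N. forward_diff (\<lambda>i. delta lam P i k) n = 0) \<longleftrightarrow>
      (\<forall>n k. n \<ge> N + 1 \<and> k \<le> N \<longrightarrow>
             delta lam P n k =
               (\<Sum>i = k..N. (- 1) ^ (N - i) * of_nat (n choose i) *
                  of_nat ((n - i - 1) choose (N - i)) * delta lam P i k))"
    unfolding forward_diff_vanish_iff_lagrange lagrange Suc_eq_plus1[symmetric] Suc_le_eq by blast
  also have "(\<forall>k>N. \<forall>n>N. forward_diff (\<lambda>i. delta lam P i k) n = 0) \<longleftrightarrow>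
      (\<forall>n k. n \<ge> k \<and> k > N \<longrightarrow> delta lam P n k = 0)"
    by (auto simp: forward_diff_delta_vanish_iff)
  finally show ?thesis
    by (simp only: diffop_eigenvector[of P lam, OF assms(2,3)] simp_thms)
qed

end
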